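(* Let $a<T$ be real numbers. (I) Consider the following conditions on a family $(J_a^\alpha)_{\alpha>0}$ of continuous linear operators on $\mathrm{L}^1(a,T)$ (real-valued functions): (1) $J_a^1=I_a^1$; (2) $J_a^\alpha J_a^\beta=J_a^{\alpha+\beta}$ for all $\alpha,\beta>0$; (3) the map $\alpha\mapsto J_a^\alpha$ from $(0,\infty)$ to $\mathcal{B}(\mathrm{L}^1(a,T))$ is continuous. Each of these conditions is necessary, i.e. for each of the three conditions there exists a family that satisfies the other two conditions but not that one. (II) Consider the following conditions on a family $(J_a^\alpha)_{\alpha>0}$ of continuous linear operators on $\mathrm{L}^1((a,T),\mathbb{C})$: (A) $J_a^1=I_a^1$; (B) $J_a^\alpha J_a^\beta=J_a^{\alpha+\beta}$ for all $\alpha,\beta>0$; (C) the map $\alpha\mapsto J_a^\alpha$ from $(0,\infty)$ to $\mathcal{B}(\mathrm{L}^1((a,T),\mathbb{C}))$ is continuous; (D) if $y\geq 0$, then $J_a^\alpha y\geq 0$ for all $\alpha>0$. Each of these conditions is necessary, i.e. for each of the four conditions there exists a family that satisfies the other three conditions but not that one. (For the necessity of (3) and of (C), Zorn's lemma is assumed.)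
   Context: $I_a^\alpha$ denotes the one-dimensional Riemann-Liouville integral of order $\alpha>0$ with left origin $a$: $I_a^\alpha f(t)=\frac{1}{\Gamma(\alpha)}\int_a^t (t-s)^{\alpha-1}f(s)\,\mathrm{d}s$. $\mathcal{B}(E)$ is the space of continuous linear maps $E\to E$, with the operator norm. It is known that conditions (1)-(3), respectively (A)-(D), characterize the family $(I_a^\alpha)_{\alpha>0}$ (Cartwright-McMullen theorem). *)

theory Defs
  imports "HOL-Analysis.Analysis"
begin

text \<open>
  The space \<open>L\<^sup>1(a,T)\<close> over a scalar field \<open>'a\<close> (used with \<open>real\<close> and \<open>complex\<close>) is handled through
  representatives: the elements are the integrable functions on \<open>(a,T)\<close>, their values outside
  \<open>(a,T)\<close> are irrelevant, and equality is equality almost everywhere. Borel representatives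
  suffice, since every Lebesgue measurable function agrees a.e. with a Borel one.
\<close>

definition interval_measure :: "real \<Rightarrow> real \<Rightarrow> real measure" where
  "interval_measure a T = restrict_space lborel {a<..<T}"

definition L1 :: "real \<Rightarrow> real \<Rightarrow> (real \<Rightarrow> 'a::{real_normed_field,banach,second_countable_topology}) set" where
  "L1 a T = {f. integrable (interval_measure a T) f}"

definition L1_eq :: "real \<Rightarrow> real \<Rightarrow> (real \<Rightarrow> 'a) \<Rightarrow> (real \<Rightarrow> 'a) \<Rightarrow> bool" where
  "L1_eq a T f g \<longleftrightarrow> (AE t in interval_measure a T. f t = g t)"

definition L1_norm :: "real \<Rightarrow> real \<Rightarrow> (real \<Rightarrow> 'a::real_normed_field) \<Rightarrow> real" where
  "L1_norm a T f = (LINT t|interval_measure a T. norm (f t))"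

text \<open>
  Continuous linear operators on \<open>L\<^sup>1(a,T)\<close>, with linearity over the field \<open>'a\<close> of values (so
  complex linearity for \<open>'a = complex\<close>). The second clause says that the map descends to classes
  of functions modulo equality almost everywhere. Continuity is boundedness, as in
  \<^const>\<open>bounded_linear\<close>.
\<close>

definition L1_operator ::
  "real \<Rightarrow> real \<Rightarrow> ((real \<Rightarrow> 'a::{real_normed_field,banach,second_countable_topology}) \<Rightarrow> (real \<Rightarrow> 'a)) \<Rightarrow> bool" where
  "L1_operator a T A \<longleftrightarrow>
     (\<forall>f\<in>L1 a T. A f \<in> L1 a T) \<and>
     (\<forall>f\<in>L1 a T. \<forall>g\<in>L1 a T. L1_eq a T f g \<longrightarrow> L1_eq a T (A f) (A g)) \<and>
     (\<forall>f\<in>L1 a T. \<forall>g\<in>L1 a T. L1_eq a T (A (\<lambda>t. f t + g t)) (\<lambda>t. A f t + A g t)) \<and>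
     (\<forall>c. \<forall>f\<in>L1 a T. L1_eq a T (A (\<lambda>t. c * f t)) (\<lambda>t. c * A f t)) \<and>
     (\<exists>C. \<forall>f\<in>L1 a T. L1_norm a T (A f) \<le> L1_norm a T f * C)"

definition L1_op_eq ::
  "real \<Rightarrow> real \<Rightarrow> ((real \<Rightarrow> 'a::{real_normed_field,banach,second_countable_topology}) \<Rightarrow> (real \<Rightarrow> 'a))
    \<Rightarrow> ((real \<Rightarrow> 'a) \<Rightarrow> (real \<Rightarrow> 'a)) \<Rightarrow> bool" where
  "L1_op_eq a T A B \<longleftrightarrow> (\<forall>f\<in>L1 a T. L1_eq a T (A f) (B f))"

text \<open>
  The operator norm, in the form of \<^const>\<open>onorm\<close> (the quotient is \<open>0\<close> for \<open>f = 0\<close>). It is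
  meaningful for bounded operators only; there the supremum is over a nonempty bounded set.
\<close>

definition L1_onorm ::
  "real \<Rightarrow> real \<Rightarrow> ((real \<Rightarrow> 'a::{real_normed_field,banach,second_countable_topology}) \<Rightarrow> (real \<Rightarrow> 'a)) \<Rightarrow> real" where
  "L1_onorm a T A = (SUP f\<in>L1 a T. L1_norm a T (A f) / L1_norm a T f)"

definition RL_integral ::
  "real \<Rightarrow> real \<Rightarrow> (real \<Rightarrow> 'a::{real_normed_field,banach,second_countable_topology}) \<Rightarrow> real \<Rightarrow> 'a" where
  "RL_integral a \<alpha> f t =
     (1 / Gamma \<alpha>) *\<^sub>R (LINT s:{a<..<t}|lborel. (t - s) powr (\<alpha> - 1) *\<^sub>R f s)"

text \<open>Families \<open>(J \<alpha>)\<close> are indexed by \<open>\<alpha> > 0\<close>; the values of \<open>J\<close> at \<open>\<alpha> \<le> 0\<close> are irrelevant.\<close>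

definition L1_operator_family ::
  "real \<Rightarrow> real \<Rightarrow> (real \<Rightarrow> (real \<Rightarrow> 'a::{real_normed_field,banach,second_countable_topology}) \<Rightarrow> (real \<Rightarrow> 'a)) \<Rightarrow> bool" where
  "L1_operator_family a T J \<longleftrightarrow> (\<forall>\<alpha>>0. L1_operator a T (J \<alpha>))"

definition interpolation_cond ::
  "real \<Rightarrow> real \<Rightarrow> (real \<Rightarrow> (real \<Rightarrow> 'a::{real_normed_field,banach,second_countable_topology}) \<Rightarrow> (real \<Rightarrow> 'a)) \<Rightarrow> bool" where
  "interpolation_cond a T J \<longleftrightarrow> L1_op_eq a T (J 1) (RL_integral a 1)"

definition index_law ::
  "real \<Rightarrow> real \<Rightarrow> (real \<Rightarrow> (real \<Rightarrow> 'a::{real_normed_field,banach,second_countable_topology}) \<Rightarrow> (real \<Rightarrow> 'a)) \<Rightarrow> bool" where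
  "index_law a T J \<longleftrightarrow> (\<forall>\<alpha>>0. \<forall>\<beta>>0. L1_op_eq a T (J \<alpha> \<circ> J \<beta>) (J (\<alpha> + \<beta>)))"

definition norm_continuous ::
  "real \<Rightarrow> real \<Rightarrow> (real \<Rightarrow> (real \<Rightarrow> 'a::{real_normed_field,banach,second_countable_topology}) \<Rightarrow> (real \<Rightarrow> 'a)) \<Rightarrow> bool" where
  "norm_continuous a T J \<longleftrightarrow>
     (\<forall>\<alpha>>0. ((\<lambda>\<beta>. L1_onorm a T (\<lambda>f t. J \<beta> f t - J \<alpha> f t)) \<longlongrightarrow> 0) (at \<alpha> within {0<..}))"

definition L1_nonneg :: "real \<Rightarrow> real \<Rightarrow> (real \<Rightarrow> complex) \<Rightarrow> bool" where
  "L1_nonneg a T y \<longleftrightarrow> (AE t in interval_measure a T. y t \<in> \<real>\<^sub>\<ge>\<^sub>0)"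

definition positivity_preserving :: "real \<Rightarrow> real \<Rightarrow> (real \<Rightarrow> (real \<Rightarrow> complex) \<Rightarrow> (real \<Rightarrow> complex)) \<Rightarrow> bool" where
  "positivity_preserving a T J \<longleftrightarrow>
     (\<forall>y\<in>L1 a T. L1_nonneg a T y \<longrightarrow> (\<forall>\<alpha>>0. L1_nonneg a T (J \<alpha> y)))"

end

theory Submission
  imports Defs
begin

text \<open>
  All counterexamples have the form \<open>c \<alpha> \<cdot> I\<^sub>a\<^sup>\<alpha>\<close> with a scalar function \<open>c\<close>. For such a family the
  conditions become conditions on \<open>c\<close>: \<open>c 1 = 1\<close>; \<open>c \<alpha> c \<beta> = c (\<alpha> + \<beta>)\<close>; continuity of \<open>c\<close>; \<open>c \<ge> 0\<close>.
  The choices \<open>c \<alpha> = 0\<close>, \<open>c \<alpha> = \<alpha>\<close>, \<open>c \<alpha> = exp (\<phi> \<alpha>)\<close> with a discontinuous additive \<open>\<phi>\<close> vanishing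
  on the rationals, and \<open>c \<alpha> = exp (2 \<pi> i \<alpha>)\<close> each violate exactly one condition.

  That \<open>I\<^sub>a\<^sup>\<alpha>\<close> itself satisfies the conditions follows by viewing it as convolution on the whole
  line with an integrable kernel: the index law is associativity of convolution together with
  Euler's Beta integral, and norm continuity follows from Young's inequality and continuity of the
  kernel in \<open>L\<^sup>1\<close> with respect to \<open>\<alpha>\<close>.
\<close>

subsection \<open>Convolution on the real line\<close>

text \<open>The kernel is real-valued even when \<open>f\<close> is complex, so one notion serves
  both scalar fields and also the convolution of two kernels. Where the integrand is not integrable
  the integral is \<open>0\<close> by default, so identities that split or iterate integrals are
  claimed almost everywhere.\<close>

definition convol :: "(real \<Rightarrow> real) \<Rightarrow> (real \<Rightarrow> 'a::{real_normed_field,banach,second_countable_topology}) \<Rightarrow> real \<Rightarrow> 'a" where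
  "convol k f t = (LINT s|lborel. k (t - s) *\<^sub>R f s)"

lemma integrable_lborel_reflect:
  fixes k :: "real \<Rightarrow> real"
  assumes "integrable lborel k"
  shows "integrable lborel (\<lambda>s. k (t - s))"
  using lborel_integrable_real_affine[OF assms, of "-1" t] by simp

text \<open>Integrating over \<open>t\<close> first, translation invariance turns the inner integral
  of norms into the constant integral of \<open>\<bar>k\<bar>\<close> times
  \<open>norm (f s)\<close>. Tonelli's criterion is therefore checked with the variables in the
  order \<open>(s, t)\<close> and swapped afterwards.\<close>

lemma convol_pair_integrable:
  fixes f :: "real \<Rightarrow> 'a::{real_normed_field,banach,second_countable_topology}"
  assumes k: "integrable lborel k" and f: "integrable lborel f"
  shows "integrable (lborel \<Otimes>\<^sub>M lborel) (\<lambda>(t, s). k (t - s) *\<^sub>R f s)"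
    and "(LINT t|lborel. LINT s|lborel. norm (k (t - s) *\<^sub>R f s))
      = (LINT t|lborel. \<bar>k t\<bar>) * (LINT s|lborel. norm (f s))"
proof -
  have [measurable]: "k \<in> borel_measurable borel" "f \<in> borel_measurable borel"
    using k f by (auto dest: borel_measurable_integrable)
  have shift: "integrable lborel (\<lambda>t. k (t - s))"
    "(LINT t|lborel. \<bar>k (t - s)\<bar>) = (LINT t|lborel. \<bar>k t\<bar>)" for s
    using lborel_integrable_real_affine[OF k, of 1 "-s"]
      lborel_integral_real_affine[of 1 "\<lambda>t. \<bar>k t\<bar>" "-s"] by simp_all
  have "integrable (lborel \<Otimes>\<^sub>M lborel) (\<lambda>(s, t). k (t - s) *\<^sub>R f s)"
  proof (rule lborel_pair.Fubini_integrable)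
    have "integrable lborel (\<lambda>s. (LINT t|lborel. \<bar>k t\<bar>) * norm (f s))"
      using f by (intro integrable_mult_right integrable_norm)
    then show "integrable lborel (\<lambda>s. LINT t|lborel. norm (case (s, t) of (s, t) \<Rightarrow> k (t - s) *\<^sub>R f s))"
      by (simp add: shift)
    show "AE s in lborel. integrable lborel (\<lambda>t. case (s, t) of (s, t) \<Rightarrow> k (t - s) *\<^sub>R f s)"
      using shift by auto
  qed measurable
  from lborel_pair.integrable_product_swap[OF this]
  show int: "integrable (lborel \<Otimes>\<^sub>M lborel) (\<lambda>(t, s). k (t - s) *\<^sub>R f s)" by simp
  have "integrable (lborel \<Otimes>\<^sub>M lborel) (\<lambda>(t, s). norm (k (t - s) *\<^sub>R f s))"
    using integrable_norm[OF int] by (simp add: case_prod_unfold)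
  from lborel_pair.Fubini_integral[OF this]
  show "(LINT t|lborel. LINT s|lborel. norm (k (t - s) *\<^sub>R f s))
      = (LINT t|lborel. \<bar>k t\<bar>) * (LINT s|lborel. norm (f s))"
    by (simp add: shift)
qed

lemma AE_convol_integrable:
  fixes f :: "real \<Rightarrow> 'a::{real_normed_field,banach,second_countable_topology}"
  assumes "integrable lborel k" and "integrable lborel f"
  shows "AE t in lborel. integrable lborel (\<lambda>s. k (t - s) *\<^sub>R f s)"
  using lborel_pair.AE_integrable_fst'[OF convol_pair_integrable(1)[OF assms]] by simp

lemma convol_integrable:
  fixes f :: "real \<Rightarrow> 'a::{real_normed_field,banach,second_countable_topology}"
  assumes "integrable lborel k" and "integrable lborel f"
  shows "integrable lborel (convol k f)"
  using lborel_pair.integrable_fst'[OF convol_pair_integrable(1)[OF assms]]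
  by (simp add: convol_def[abs_def])

text \<open>Young's inequality for two integrable functions: take the norm inside the integral, then
  evaluate the double integral.\<close>

lemma norm_convol_le:
  fixes f :: "real \<Rightarrow> 'a::{real_normed_field,banach,second_countable_topology}"
  assumes k: "integrable lborel k" and f: "integrable lborel f"
  shows "(LINT t|lborel. norm (convol k f t)) \<le> (LINT t|lborel. \<bar>k t\<bar>) * (LINT s|lborel. norm (f s))"
proof -
  have "(LINT t|lborel. norm (convol k f t)) \<le> (LINT t|lborel. LINT s|lborel. norm (k (t - s) *\<^sub>R f s))"
  proof (rule integral_mono)
    show "integrable lborel (\<lambda>t. LINT s|lborel. norm (k (t - s) *\<^sub>R f s))"
      using lborel_pair.integrable_fst'[OF integrable_norm[OF convol_pair_integrable(1)[OF k f]]]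
      by (simp only: prod.case)
    show "integrable lborel (\<lambda>t. norm (convol k f t))"
      using convol_integrable[OF k f] by (rule integrable_norm)
    show "norm (convol k f t) \<le> (LINT s|lborel. norm (k (t - s) *\<^sub>R f s))" for t
      unfolding convol_def by (rule integral_norm_bound)
  qed
  then show ?thesis
    by (simp only: convol_pair_integrable(2)[OF k f])
qed

text \<open>Fubini in the two inner variables for fixed \<open>t\<close>. The double integral
  converges absolutely only for almost every \<open>t\<close>, hence the exceptional null
  set.\<close>

lemma convol_assoc:
  fixes f :: "real \<Rightarrow> 'a::{real_normed_field,banach,second_countable_topology}"
  assumes h: "integrable lborel h" and k: "integrable lborel k" and f: "integrable lborel f"
  shows "AE t in lborel. convol h (convol k f) t = convol (convol h k) f t"
proof -
  have [measurable]: "h \<in> borel_measurable borel" "k \<in> borel_measurable borel" "f \<in> borel_measurable borel"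
    using h k f by (auto dest: borel_measurable_integrable)
  \<comment> \<open>\<open>?g s\<close> is the inner integral of the norms, so integrability of
    \<open>\<bar>h (t - s)\<bar> *\<^sub>R ?g s\<close> in \<open>s\<close> is exactly absolute
    convergence of the double integral at \<open>t\<close>.\<close>
  let ?g = "convol (\<lambda>s. \<bar>k s\<bar>) (\<lambda>s. norm (f s))"
  have g: "integrable lborel ?g"
    using k f by (intro convol_integrable integrable_norm integrable_abs)
  have "AE t in lborel. integrable lborel (\<lambda>s. \<bar>h (t - s)\<bar> *\<^sub>R ?g s)"
    using AE_convol_integrable[OF integrable_abs[OF h] g] .
  then show ?thesis
  proof eventually_elim
    case (elim t)
    have int: "integrable (lborel \<Otimes>\<^sub>M lborel) (\<lambda>(s, r). h (t - s) *\<^sub>R k (s - r) *\<^sub>R f r)"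
    proof (rule lborel_pair.Fubini_integrable)
      show "integrable lborel (\<lambda>s. LINT r|lborel.
          norm (case (s, r) of (s, r) \<Rightarrow> h (t - s) *\<^sub>R k (s - r) *\<^sub>R f r))"
        using elim by (simp add: convol_def abs_mult mult.assoc)
      show "AE s in lborel. integrable lborel (\<lambda>r. case (s, r) of (s, r) \<Rightarrow> h (t - s) *\<^sub>R k (s - r) *\<^sub>R f r)"
        using AE_convol_integrable[OF k f]
        by eventually_elim (simp only: prod.case integrable_scaleR_right)
    qed measurable
    have "convol h (convol k f) t = (LINT s|lborel. LINT r|lborel. h (t - s) *\<^sub>R k (s - r) *\<^sub>R f r)"
      by (simp only: convol_def integral_scaleR_right)
    also have "\<dots> = (LINT r|lborel. LINT s|lborel. h (t - s) *\<^sub>R k (s - r) *\<^sub>R f r)"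
      using lborel_pair.Fubini_integral[OF int] by simp
    also have "\<dots> = (LINT r|lborel. convol h k (t - r) *\<^sub>R f r)"
    proof (rule integral_cong_AE)
      \<comment> \<open>Translation of the integration variable by \<open>r\<close>.\<close>
      have *: "convol h k (t - r) = (LINT s|lborel. h (t - s) * k (s - r))" for r
        using lborel_integral_real_affine[of 1 "\<lambda>s. h (t - r - s) * k s" "-r"]
        by (simp add: convol_def)
      show "AE r in lborel. (LINT s|lborel. h (t - s) *\<^sub>R k (s - r) *\<^sub>R f r) = convol h k (t - r) *\<^sub>R f r"
        using lborel_pair.AE_integrable_snd[OF int]
      proof eventually_elim
        case (elim r)
        show ?case
        \<comment> \<open>Integrability of the scalar factor can be recovered from that of the
          product by cancelling \<open>norm (f r)\<close>; if \<open>f r = 0\<close>, both sides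
          vanish.\<close>
        proof (cases "f r = 0")
          case False
          have "integrable lborel (\<lambda>s. norm (f r) * (h (t - s) * k (s - r)))"
            using integrable_norm[OF elim]
            by (subst integrable_norm_iff[symmetric]) (auto simp: abs_mult mult_ac)
          then have "integrable lborel (\<lambda>s. h (t - s) * k (s - r))"
            using False by simp
          then show ?thesis by (simp add: * integral_scaleR_left)
        qed simp
      qed
      show "(\<lambda>r. LINT s|lborel. h (t - s) *\<^sub>R k (s - r) *\<^sub>R f r) \<in> borel_measurable lborel"
        by measurable
      have [measurable]: "convol h k \<in> borel_measurable borel"
        using convol_integrable[OF h k] by (auto dest: borel_measurable_integrable)
      show "(\<lambda>r. convol h k (t - r) *\<^sub>R f r) \<in> borel_measurable lborel"
        by measurable
    qed
    finally show ?case by (simp add: convol_def)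
  qed
qed

subsection \<open>The Riemann--Liouville kernel\<close>

text \<open>Truncation at \<open>L\<close> makes the power function integrable on the whole line.
  With \<open>L = T - a\<close> nothing is lost, because \<open>t - s < T - a\<close> whenever
  \<open>a < s\<close> and \<open>t < T\<close>.\<close>

definition rl_kernel :: "real \<Rightarrow> real \<Rightarrow> real \<Rightarrow> real" where
  "rl_kernel L \<alpha> s = (if 0 < s \<and> s < L then s powr (\<alpha> - 1) / Gamma \<alpha> else 0)"

lemma rl_kernel_measurable [measurable]: "rl_kernel L \<alpha> \<in> borel_measurable borel"
  unfolding rl_kernel_def[abs_def] by measurable

lemma rl_kernel_nonneg: "\<alpha> > 0 \<Longrightarrow> rl_kernel L \<alpha> s \<ge> 0"
  by (simp add: rl_kernel_def Gamma_real_pos less_imp_le)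

lemma rl_kernel_integrable:
  assumes "\<alpha> > 0" "L > 0"
  shows "integrable lborel (rl_kernel L \<alpha>)"
proof -
  have "(\<lambda>s. s powr (\<alpha> - 1)) integrable_on {0..L}"
    using assms by (intro integrable_on_powr_from_0) auto
  then have "(\<lambda>s. s powr (\<alpha> - 1)) absolutely_integrable_on {0..L}"
    by (subst absolutely_integrable_on_iff_nonneg) auto
  then have "integrable lborel (\<lambda>s. indicator {0..L} s *\<^sub>R s powr (\<alpha> - 1))"
    unfolding set_integrable_def by (subst (asm) integrable_completion) auto
  then have "integrable lborel (\<lambda>s. (indicator {0..L} s *\<^sub>R s powr (\<alpha> - 1)) / Gamma \<alpha>)"
    by (rule integrable_divide)
  then show ?thesis
    by (rule Bochner_Integration.integrable_bound) (auto simp: rl_kernel_def indicator_def)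
qed

text \<open>The substitution \<open>s = u * x\<close> reduces the convolution to Euler's integral
  for \<open>Beta \<beta> \<alpha>\<close>, whose Gamma factors cancel against the normalisations.
  Since \<open>u < L\<close>, the truncation is not felt by arguments between \<open>0\<close> and
  \<open>u\<close>.\<close>

lemma convol_rl_kernel:
  assumes "\<alpha> > 0" "\<beta> > 0" "u < L"
  shows "convol (rl_kernel L \<alpha>) (rl_kernel L \<beta>) u = rl_kernel L (\<alpha> + \<beta>) u"
proof (cases "u > 0")
  case False
  then have "rl_kernel L \<alpha> (u - s) * rl_kernel L \<beta> s = 0" for s
    by (auto simp: rl_kernel_def)
  then have "convol (rl_kernel L \<alpha>) (rl_kernel L \<beta>) u = 0"
    by (simp only: convol_def real_scaleR_def integral_zero)
  then show ?thesis using False by (simp add: rl_kernel_def)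
next
  case u: True
  let ?b = "\<lambda>x. x powr (\<beta> - 1) * (1 - x) powr (\<alpha> - 1)"
  have "(LINT x:{0..1}|lborel. ?b x) = Beta \<beta> \<alpha>"
    using set_borel_integral_eq_integral(2)[OF integrable_Beta[of \<beta> \<alpha>]]
      integral_unique[OF has_integral_Beta_real[of \<beta> \<alpha>]] assms by simp
  then have b: "(LINT x|lborel. indicator {0..1} x * ?b x) = Beta \<beta> \<alpha>"
    by (simp add: set_lebesgue_integral_def)
  have "convol (rl_kernel L \<alpha>) (rl_kernel L \<beta>) u
      = u * (LINT x|lborel. rl_kernel L \<alpha> (u - u * x) * rl_kernel L \<beta> (u * x))"
    using u lborel_integral_real_affine[of u "\<lambda>s. rl_kernel L \<alpha> (u - s) * rl_kernel L \<beta> s" 0]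
    by (simp add: convol_def)
  also have "(\<lambda>x. rl_kernel L \<alpha> (u - u * x) * rl_kernel L \<beta> (u * x))
      = (\<lambda>x. u powr (\<alpha> + \<beta> - 2) / (Gamma \<alpha> * Gamma \<beta>) * (indicator {0..1} x * ?b x))"
  proof
    fix x :: real
    consider "x \<le> 0" | "x \<ge> 1" | "0 < x" "x < 1" by linarith
    then show "rl_kernel L \<alpha> (u - u * x) * rl_kernel L \<beta> (u * x)
      = u powr (\<alpha> + \<beta> - 2) / (Gamma \<alpha> * Gamma \<beta>) * (indicator {0..1} x * ?b x)"
    proof cases
      case 1
      then show ?thesis using u by (auto simp: rl_kernel_def indicator_def zero_less_mult_iff)
    next
      case 2
      then have "u - u * x \<le> 0" using u by simp
      then show ?thesis using 2 by (auto simp: rl_kernel_def indicator_def)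
    next
      case 3
      have ux: "0 < u * x" "u * x < u" using 3 u by auto
      then have "u * x < L" "u - u * x < L" using \<open>u < L\<close> by linarith+
      moreover have "u - u * x = u * (1 - x)" by (simp add: algebra_simps)
      then have "(u - u * x) powr (\<alpha> - 1) = u powr (\<alpha> - 1) * (1 - x) powr (\<alpha> - 1)"
        using 3 u by (simp add: powr_mult)
      moreover have "u powr (\<alpha> + \<beta> - 2) = u powr (\<alpha> - 1) * u powr (\<beta> - 1)"
        by (simp add: powr_add[symmetric] algebra_simps)
      ultimately show ?thesis
        using 3 u ux by (simp add: rl_kernel_def powr_mult)
    qed
  qed
  also have "u * (LINT x|lborel. u powr (\<alpha> + \<beta> - 2) / (Gamma \<alpha> * Gamma \<beta>) * (indicator {0..1} x * ?b x))
     = u * u powr (\<alpha> + \<beta> - 2) / Gamma (\<alpha> + \<beta>)"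
    using Gamma_real_pos[OF assms(1)] Gamma_real_pos[OF assms(2)]
    by (simp only: integral_mult_right_zero b) (simp add: Beta_def add.commute)
  also have "u * u powr (\<alpha> + \<beta> - 2) = u powr (\<alpha> + \<beta> - 1)"
    using u by (simp add: powr_mult_base algebra_simps)
  finally show ?thesis using u assms by (simp add: rl_kernel_def[of L "\<alpha> + \<beta>"])
qed

text \<open>Dominated convergence along an arbitrary sequence of orders tending to
  \<open>\<alpha>\<close>.\<close>

lemma rl_kernel_L1_continuous:
  assumes \<alpha>: "\<alpha> > 0" and L: "L > 0"
  shows "((\<lambda>\<beta>. LINT s|lborel. \<bar>rl_kernel L \<beta> s - rl_kernel L \<alpha> s\<bar>) \<longlongrightarrow> 0) (at \<alpha>)"
  unfolding tendsto_at_iff_sequentially o_def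
proof (intro allI impI)
  fix X :: "nat \<Rightarrow> real"
  assume X: "X \<longlonglongrightarrow> \<alpha>"
  have \<Gamma>: "Gamma \<alpha> > 0" using \<alpha> by (rule Gamma_real_pos)
  have \<alpha>': "\<alpha> \<notin> \<int>\<^sub>\<le>\<^sub>0" using \<alpha> by (auto elim!: nonpos_Ints_cases)
  then have G: "(\<lambda>n. Gamma (X n)) \<longlonglongrightarrow> Gamma \<alpha>"
    by (intro tendsto_Gamma X)
  have "\<forall>\<^sub>F n in sequentially. \<alpha>/2 < X n \<and> X n < 2 * \<alpha> \<and> Gamma \<alpha> / 2 < Gamma (X n)"
    using order_tendstoD(1)[OF X, of "\<alpha>/2"] order_tendstoD(2)[OF X, of "2*\<alpha>"]
      order_tendstoD(1)[OF G, of "Gamma \<alpha> / 2"] \<alpha> \<Gamma>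
    by (intro eventually_conj) auto
  \<comment> \<open>Passing to the tail from \<open>N\<close> on keeps the orders between
    \<open>\<alpha>/2\<close> and \<open>2 * \<alpha>\<close> and bounds
    \<open>1 / Gamma (X n)\<close>, so that a single majorant serves all terms.\<close>
  then obtain N where N: "\<And>n. n \<ge> N \<Longrightarrow> \<alpha>/2 < X n \<and> X n < 2 * \<alpha> \<and> Gamma \<alpha> / 2 < Gamma (X n)"
    by (auto simp: eventually_sequentially)
  \<comment> \<open>For \<open>s \<le> 1\<close> the smallest exponent dominates, for
    \<open>s > 1\<close> the largest; their sum covers both cases. \<open>A\<close> and
    \<open>B\<close> replace the Gamma normalisations of the two extreme kernels by
    \<open>2 / Gamma \<alpha>\<close>, and the last summand of \<open>w\<close> accounts for the
    limit kernel.\<close>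
  define A where "A = (2 / Gamma \<alpha>) * Gamma (\<alpha>/2)"
  define B where "B = (2 / Gamma \<alpha>) * Gamma (2*\<alpha>)"
  define w where "w s = A * rl_kernel L (\<alpha>/2) s + B * rl_kernel L (2*\<alpha>) s + rl_kernel L \<alpha> s" for s
  have "(\<lambda>n. LINT s|lborel. \<bar>rl_kernel L (X (n + N)) s - rl_kernel L \<alpha> s\<bar>) \<longlonglongrightarrow> (LINT s|(lborel :: real measure). (0::real))"
  proof (rule integral_dominated_convergence)
    show "integrable lborel w"
      unfolding w_def using \<alpha> L
      by (intro Bochner_Integration.integrable_add integrable_mult_right rl_kernel_integrable) auto
    have "(\<lambda>n. rl_kernel L (X n) s) \<longlonglongrightarrow> rl_kernel L \<alpha> s" for s
      using X G \<Gamma> \<alpha>' by (cases "0 < s \<and> s < L") (auto simp: rl_kernel_def intro!: tendsto_eq_intros)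
    then have "(\<lambda>n. \<bar>rl_kernel L (X (n + N)) s - rl_kernel L \<alpha> s\<bar>) \<longlonglongrightarrow> 0" for s
      by (intro tendsto_rabs_zero LIM_zero LIMSEQ_ignore_initial_segment)
    then show "AE s in lborel. (\<lambda>n. \<bar>rl_kernel L (X (n + N)) s - rl_kernel L \<alpha> s\<bar>) \<longlonglongrightarrow> 0"
      by simp
    show "AE s in lborel. norm \<bar>rl_kernel L (X (n + N)) s - rl_kernel L \<alpha> s\<bar> \<le> w s" for n
    proof (rule AE_I2)
      fix s
      let ?x = "X (n + N)"
      have x: "\<alpha>/2 < ?x" "?x < 2 * \<alpha>" "Gamma \<alpha> / 2 < Gamma ?x" using N[of "n + N"] by auto
      have "rl_kernel L ?x s \<le> A * rl_kernel L (\<alpha>/2) s + B * rl_kernel L (2*\<alpha>) s"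
      proof (cases "0 < s \<and> s < L")
        case True
        have "s powr (?x - 1) \<le> s powr (\<alpha>/2 - 1) + s powr (2*\<alpha> - 1)"
        proof (cases "s \<le> 1")
          case le: True
          have "s powr (?x - 1) \<le> s powr (\<alpha>/2 - 1)"
            using True le x by (intro powr_mono') auto
          then show ?thesis by (simp add: add_increasing2)
        next
          case False
          then have "s powr (?x - 1) \<le> s powr (2*\<alpha> - 1)"
            using x by (intro powr_mono) auto
          then show ?thesis by (simp add: add_increasing)
        qed
        moreover have "1 / Gamma ?x \<le> 2 / Gamma \<alpha>"
          using x \<Gamma> by (simp add: field_simps)
        ultimately have "(1 / Gamma ?x) * s powr (?x - 1) \<le> (2 / Gamma \<alpha>) * (s powr (\<alpha>/2 - 1) + s powr (2*\<alpha> - 1))"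
          using x \<Gamma> by (intro mult_mono) auto
        moreover have "Gamma (\<alpha>/2) > 0" "Gamma (2*\<alpha>) > 0"
          using \<alpha> by (auto intro!: Gamma_real_pos)
        ultimately show ?thesis
          using True by (simp add: rl_kernel_def A_def B_def ring_distribs)
      qed (auto simp: rl_kernel_def)
      moreover have "rl_kernel L ?x s \<ge> 0" "rl_kernel L \<alpha> s \<ge> 0"
        using \<alpha> x by (auto intro!: rl_kernel_nonneg)
      ultimately show "norm \<bar>rl_kernel L ?x s - rl_kernel L \<alpha> s\<bar> \<le> w s"
        by (simp add: w_def)
    qed
  qed measurable
  then show "(\<lambda>n. LINT s|lborel. \<bar>rl_kernel L (X n) s - rl_kernel L \<alpha> s\<bar>) \<longlonglongrightarrow> 0"
    by (simp add: LIMSEQ_offset[of _ N])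
qed

subsection \<open>Riemann--Liouville integrals as operators\<close>

text \<open>Extension by zero from the interval to the line: it discards the irrelevant values
  outside \<open>(a,T)\<close> and makes the convolution lemmas applicable.\<close>

definition cutoff :: "real \<Rightarrow> real \<Rightarrow> (real \<Rightarrow> 'a::real_normed_field) \<Rightarrow> real \<Rightarrow> 'a" where
  "cutoff a T f s = indicator {a<..<T} s *\<^sub>R f s"

section \<open>The space L^1(a,T) in terms of functions on the whole line\<close>

lemma L1_iff: "f \<in> L1 a T \<longleftrightarrow> integrable lborel (cutoff a T f)"
  by (simp add: L1_def Defs.interval_measure_def integrable_restrict_space cutoff_def[abs_def])

lemma L1_eq_iff: "L1_eq a T f g \<longleftrightarrow> (AE t in lborel. a < t \<and> t < T \<longrightarrow> f t = g t)"
  unfolding L1_eq_def Defs.interval_measure_def by (subst AE_restrict_space_iff) auto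

lemma L1_nonneg_iff: "L1_nonneg a T y \<longleftrightarrow> (AE t in lborel. a < t \<and> t < T \<longrightarrow> y t \<in> \<real>\<^sub>\<ge>\<^sub>0)"
  unfolding L1_nonneg_def Defs.interval_measure_def by (subst AE_restrict_space_iff) auto

lemma L1_norm_cutoff:
  fixes f :: "real \<Rightarrow> 'a::{real_normed_field,banach,second_countable_topology}"
  shows "L1_norm a T f = (LINT t|lborel. norm (cutoff a T f t))"
  by (simp add: L1_norm_def Defs.interval_measure_def integral_restrict_space cutoff_def)

lemma L1_norm_nonneg: "L1_norm a T f \<ge> 0"
  by (simp add: L1_norm_def)

lemma L1_mult:
  fixes f :: "real \<Rightarrow> 'a::{real_normed_field,banach,second_countable_topology}"
  shows "f \<in> L1 a T \<Longrightarrow> (\<lambda>t. c * f t) \<in> L1 a T"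
  by (simp add: L1_def)

lemma L1_norm_add_le:
  fixes f :: "real \<Rightarrow> 'a::{real_normed_field,banach,second_countable_topology}"
  assumes "f \<in> L1 a T" "g \<in> L1 a T"
  shows "L1_norm a T (\<lambda>t. f t + g t) \<le> L1_norm a T f + L1_norm a T g"
proof -
  have "L1_norm a T (\<lambda>t. f t + g t) \<le> (LINT t|interval_measure a T. norm (f t) + norm (g t))"
    using assms unfolding L1_norm_def L1_def
    by (intro integral_mono) (auto intro: norm_triangle_ineq)
  then show ?thesis
    using assms by (simp add: L1_norm_def L1_def)
qed

lemma L1_norm_mult:
  fixes f :: "real \<Rightarrow> 'a::{real_normed_field,banach,second_countable_topology}"
  shows "L1_norm a T (\<lambda>t. c * f t) = norm c * L1_norm a T f"
  by (simp add: L1_norm_def norm_mult)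

lemma L1_norm_cong:
  fixes f :: "real \<Rightarrow> 'a::{real_normed_field,banach,second_countable_topology}"
  assumes "f \<in> L1 a T" "g \<in> L1 a T" "L1_eq a T f g"
  shows "L1_norm a T f = L1_norm a T g"
  using assms unfolding L1_norm_def L1_def L1_eq_def
  by (intro integral_cong_AE) (auto dest: borel_measurable_integrable)

text \<open>The constant \<open>1\<close> is the test function by which conditions on the operators
  are turned into conditions on their scalar factors.\<close>

lemma const_in_L1: "(\<lambda>_. c) \<in> L1 a T"
  unfolding L1_def Defs.interval_measure_def mem_Collect_eq
  by (cases "a \<le> T"; subst integrable_restrict_space)
    (auto intro!: integrable_scaleR_left integrable_real_indicator)

lemma convol_cutoff_in_L1:
  fixes f :: "real \<Rightarrow> 'a::{real_normed_field,banach,second_countable_topology}"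
  assumes "integrable lborel k" "f \<in> L1 a T"
  shows "convol k (cutoff a T f) \<in> L1 a T"
  unfolding L1_def Defs.interval_measure_def mem_Collect_eq
  using convol_integrable[OF assms[unfolded L1_iff]]
  by (subst integrable_restrict_space) (auto intro!: integrable_mult_indicator)

lemma L1_norm_convol_cutoff_le:
  fixes f :: "real \<Rightarrow> 'a::{real_normed_field,banach,second_countable_topology}"
  assumes k: "integrable lborel k" and f: "f \<in> L1 a T"
  shows "L1_norm a T (convol k (cutoff a T f)) \<le> (LINT s|lborel. \<bar>k s\<bar>) * L1_norm a T f"
proof -
  have "L1_norm a T (convol k (cutoff a T f)) \<le> (LINT t|lborel. norm (convol k (cutoff a T f) t))"
    unfolding L1_norm_cutoff
  proof (intro integral_mono integrable_norm)
    show "integrable lborel (cutoff a T (convol k (cutoff a T f)))"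
      using convol_cutoff_in_L1[OF k f] by (simp add: L1_iff)
    show "integrable lborel (convol k (cutoff a T f))"
      using convol_integrable[OF k] f by (simp add: L1_iff)
  qed (simp add: cutoff_def indicator_def)
  also have "\<dots> \<le> (LINT s|lborel. \<bar>k s\<bar>) * L1_norm a T f"
    using norm_convol_le[OF k f[unfolded L1_iff]] by (simp add: L1_norm_cutoff)
  finally show ?thesis .
qed

text \<open>For each fixed \<open>t\<close> the two integrands differ only on a null set, so
  equality holds at every \<open>t\<close>.\<close>

lemma convol_cutoff_cong:
  fixes f :: "real \<Rightarrow> 'a::{real_normed_field,banach,second_countable_topology}"
  assumes k: "integrable lborel k" and f: "f \<in> L1 a T" and g: "g \<in> L1 a T" and "L1_eq a T f g"
  shows "convol k (cutoff a T f) t = convol k (cutoff a T g) t"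
proof -
  have [measurable]: "k \<in> borel_measurable borel"
    "cutoff a T f \<in> borel_measurable borel" "cutoff a T g \<in> borel_measurable borel"
    using k f g by (auto simp: L1_iff dest: borel_measurable_integrable)
  have "AE s in lborel. k (t - s) *\<^sub>R cutoff a T f s = k (t - s) *\<^sub>R cutoff a T g s"
    using \<open>L1_eq a T f g\<close> unfolding L1_eq_iff by eventually_elim (auto simp: cutoff_def indicator_def)
  then show ?thesis
    unfolding convol_def by (intro integral_cong_AE) measurable
qed

section \<open>The Riemann-Liouville integral as a truncated convolution\<close>

text \<open>The integrands agree at every \<open>s\<close>: the cutoff supplies
  \<open>a < s\<close>, the support of the kernel supplies \<open>s < t\<close>, and the truncation
  length \<open>T - a\<close> is never reached.\<close>

lemma RL_integral_eq_convol:
  fixes f :: "real \<Rightarrow> 'a::{real_normed_field,banach,second_countable_topology}"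
  assumes "a < t" "t < T"
  shows "RL_integral a \<alpha> f t = convol (rl_kernel (T - a) \<alpha>) (cutoff a T f) t"
proof -
  have "RL_integral a \<alpha> f t
      = (LINT s|lborel. (1 / Gamma \<alpha>) *\<^sub>R indicator {a<..<t} s *\<^sub>R (t - s) powr (\<alpha> - 1) *\<^sub>R f s)"
    unfolding RL_integral_def set_lebesgue_integral_def integral_scaleR_right ..
  also have "\<dots> = convol (rl_kernel (T - a) \<alpha>) (cutoff a T f) t"
    unfolding convol_def using assms
    by (intro Bochner_Integration.integral_cong) (auto simp: rl_kernel_def cutoff_def indicator_def)
  finally show ?thesis .
qed

lemma cutoff_RL_integral:
  "cutoff a T (RL_integral a \<alpha> f) = cutoff a T (convol (rl_kernel (T - a) \<alpha>) (cutoff a T f))"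
  using RL_integral_eq_convol[of a _ T] by (auto simp: cutoff_def indicator_def fun_eq_iff)

lemma RL_integral_in_L1:
  assumes "a < T" "\<alpha> > 0" "f \<in> L1 a T"
  shows "RL_integral a \<alpha> f \<in> L1 a T"
  using convol_cutoff_in_L1[OF rl_kernel_integrable[of \<alpha> "T - a"], of f a T] assms
  by (simp add: L1_iff cutoff_RL_integral)

lemma RL_integral_norm_le:
  fixes f :: "real \<Rightarrow> 'a::{real_normed_field,banach,second_countable_topology}"
  assumes "a < T" "\<alpha> > 0" "f \<in> L1 a T"
  shows "L1_norm a T (RL_integral a \<alpha> f) \<le> (LINT s|lborel. \<bar>rl_kernel (T - a) \<alpha> s\<bar>) * L1_norm a T f"
  using L1_norm_convol_cutoff_le[OF rl_kernel_integrable[of \<alpha> "T - a"], of f a T] assms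
  by (simp add: L1_norm_cutoff cutoff_RL_integral)

text \<open>Additivity of the integral requires both integrands to be integrable, which is known at
  almost every \<open>t\<close>.\<close>

lemma RL_integral_add:
  fixes f :: "real \<Rightarrow> 'a::{real_normed_field,banach,second_countable_topology}"
  assumes "a < T" "\<alpha> > 0" "f \<in> L1 a T" "g \<in> L1 a T"
  shows "L1_eq a T (RL_integral a \<alpha> (\<lambda>t. f t + g t)) (\<lambda>t. RL_integral a \<alpha> f t + RL_integral a \<alpha> g t)"
proof -
  have k: "integrable lborel (rl_kernel (T - a) \<alpha>)"
    using assms by (intro rl_kernel_integrable) auto
  have eq: "cutoff a T (\<lambda>t. f t + g t) = (\<lambda>s. cutoff a T f s + cutoff a T g s)"
    by (simp add: cutoff_def fun_eq_iff scaleR_right_distrib)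
  show ?thesis
    unfolding L1_eq_iff
    using AE_convol_integrable[OF k assms(3)[unfolded L1_iff]]
      AE_convol_integrable[OF k assms(4)[unfolded L1_iff]]
    by eventually_elim
      (auto simp: RL_integral_eq_convol[of a _ T] eq convol_def scaleR_right_distrib)
qed

lemma RL_integral_mult: "RL_integral a \<alpha> (\<lambda>t. c * f t) t = c * RL_integral a \<alpha> f t"
  unfolding RL_integral_def set_lebesgue_integral_def
  by (simp only: mult_scaleR_right[symmetric] integral_mult_right_zero)

text \<open>Associativity moves the composition to the kernels, where the Beta integral applies.
  What remains is to check that the cutoffs do not interfere.\<close>

lemma RL_integral_semigroup:
  fixes f :: "real \<Rightarrow> 'a::{real_normed_field,banach,second_countable_topology}"
  assumes aT: "a < T" and "\<alpha> > 0" "\<beta> > 0" and f: "f \<in> L1 a T"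
  shows "L1_eq a T (RL_integral a \<alpha> (RL_integral a \<beta> f)) (RL_integral a (\<alpha> + \<beta>) f)"
proof -
  let ?k = "rl_kernel (T - a)" and ?f = "cutoff a T f"
  have k: "integrable lborel (?k \<alpha>)" "integrable lborel (?k \<beta>)"
    using assms by (auto intro!: rl_kernel_integrable)
  have "AE t in lborel. convol (?k \<alpha>) (convol (?k \<beta>) ?f) t = convol (convol (?k \<alpha>) (?k \<beta>)) ?f t"
    using convol_assoc[OF k] f by (simp add: L1_iff)
  then show ?thesis
    unfolding L1_eq_iff
  proof eventually_elim
    case (elim t)
    show ?case
    proof
      assume t: "a < t \<and> t < T"
      have zero: "convol (?k \<beta>) ?f s = 0" if "s \<le> a" for s
      proof -
        have "?k \<beta> (s - r) *\<^sub>R ?f r = 0" for r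
          using that by (auto simp: rl_kernel_def cutoff_def indicator_def)
        then show ?thesis unfolding convol_def by (simp only: integral_zero)
      qed
      have "RL_integral a \<alpha> (RL_integral a \<beta> f) t = convol (?k \<alpha>) (cutoff a T (convol (?k \<beta>) ?f)) t"
        using t by (simp add: RL_integral_eq_convol[of a _ T] cutoff_RL_integral)
      also have "\<dots> = convol (?k \<alpha>) (convol (?k \<beta>) ?f) t"
        unfolding convol_def[of "?k \<alpha>"]
      proof (intro Bochner_Integration.integral_cong refl)
        fix s
        show "?k \<alpha> (t - s) *\<^sub>R cutoff a T (convol (?k \<beta>) ?f) s = ?k \<alpha> (t - s) *\<^sub>R convol (?k \<beta>) ?f s"
          using t zero[of s] by (cases "s \<le> a"; cases "s < t") (auto simp: rl_kernel_def cutoff_def)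
      qed
      also have "\<dots> = convol (convol (?k \<alpha>) (?k \<beta>)) ?f t" by (rule elim)
      \<comment> \<open>Where \<open>?f s\<close> is nonzero, \<open>a < s\<close> gives
        \<open>t - s < T - a\<close>, the range in which the kernels satisfy the index law.\<close>
      also have "\<dots> = convol (?k (\<alpha> + \<beta>)) ?f t"
        unfolding convol_def[of _ ?f] using t assms
        by (intro Bochner_Integration.integral_cong)
          (auto simp: convol_rl_kernel cutoff_def indicator_def)
      also have "\<dots> = RL_integral a (\<alpha> + \<beta>) f t"
        using t by (simp add: RL_integral_eq_convol[of a _ T])
      finally show "RL_integral a \<alpha> (RL_integral a \<beta> f) t = RL_integral a (\<alpha> + \<beta>) f t" .
    qed
  qed
qed

text \<open>The difference is almost everywhere the convolution with the difference of the kernels.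
  Young's inequality thus transfers the continuity of the kernels in L^1 to the operator
  norm.\<close>

lemma RL_integral_diff_norm_le:
  fixes f :: "real \<Rightarrow> 'a::{real_normed_field,banach,second_countable_topology}"
  assumes "a < T" "\<alpha> > 0" "\<beta> > 0" and f: "f \<in> L1 a T"
  shows "L1_norm a T (\<lambda>t. RL_integral a \<beta> f t - RL_integral a \<alpha> f t)
    \<le> (LINT s|lborel. \<bar>rl_kernel (T - a) \<beta> s - rl_kernel (T - a) \<alpha> s\<bar>) * L1_norm a T f"
proof -
  let ?k = "rl_kernel (T - a)" and ?f = "cutoff a T f"
  let ?d = "\<lambda>s. ?k \<beta> s - ?k \<alpha> s"
  have k: "integrable lborel (?k \<alpha>)" "integrable lborel (?k \<beta>)"
    using assms by (auto intro!: rl_kernel_integrable)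
  then have d: "integrable lborel ?d" by (rule Bochner_Integration.integrable_diff[rotated])
  have "L1_eq a T (\<lambda>t. RL_integral a \<beta> f t - RL_integral a \<alpha> f t) (convol ?d ?f)"
    unfolding L1_eq_iff
    using AE_convol_integrable[OF k(1) f[unfolded L1_iff]]
      AE_convol_integrable[OF k(2) f[unfolded L1_iff]]
    by eventually_elim
      (auto simp: RL_integral_eq_convol[of a _ T] convol_def scaleR_left_diff_distrib)
  moreover have "(\<lambda>t. RL_integral a \<beta> f t - RL_integral a \<alpha> f t) \<in> L1 a T"
    using RL_integral_in_L1[OF assms(1,2) f] RL_integral_in_L1[OF assms(1,3) f] by (simp add: L1_def)
  ultimately have "L1_norm a T (\<lambda>t. RL_integral a \<beta> f t - RL_integral a \<alpha> f t) = L1_norm a T (convol ?d ?f)"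
    using convol_cutoff_in_L1[OF d f] by (intro L1_norm_cong)
  then show ?thesis using L1_norm_convol_cutoff_le[OF d f] by simp
qed

section \<open>Operator norm, constant test function and positivity\<close>

text \<open>The interval has positive measure, so a property valid almost everywhere can be
  evaluated at some point of it.\<close>

lemma L1_AE_ex:
  fixes a T :: real
  assumes "a < T" "AE t in lborel. a < t \<and> t < T \<longrightarrow> P t"
  shows "\<exists>t. a < t \<and> t < T \<and> P t"
proof (rule ccontr)
  assume "\<not> ?thesis"
  with assms(2) have "AE t in lborel. t \<notin> {a<..<T}"
    by (auto elim!: eventually_mono)
  then have "emeasure lborel {a<..<T} = 0"
    by (subst (asm) AE_iff_measurable[where N = "{a<..<T}"]) auto
  with \<open>a < T\<close> show False by simp
qed

text \<open>An a priori bound makes the set of quotients bounded above, so the real supremum behaves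
  as a least upper bound.\<close>

lemma L1_onorm_le:
  fixes A :: "(real \<Rightarrow> 'a::{real_normed_field,banach,second_countable_topology}) \<Rightarrow> (real \<Rightarrow> 'a)"
  assumes bound: "\<And>f. f \<in> L1 a T \<Longrightarrow> L1_norm a T (A f) \<le> C * L1_norm a T f" and "C \<ge> 0"
  shows "0 \<le> L1_onorm a T A" and "L1_onorm a T A \<le> C"
    and "\<And>f. f \<in> L1 a T \<Longrightarrow> L1_norm a T f > 0 \<Longrightarrow> L1_norm a T (A f) \<le> L1_onorm a T A * L1_norm a T f"
proof -
  let ?q = "\<lambda>f. L1_norm a T (A f) / L1_norm a T f"
  \<comment> \<open>If \<open>f\<close> has norm zero, the quotient is \<open>0\<close> by the
    convention on division, which is where \<open>C \<ge> 0\<close> enters.\<close>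
  have q: "?q f \<le> C" if "f \<in> L1 a T" for f
    using bound[OF that] L1_norm_nonneg[of a T f] \<open>C \<ge> 0\<close>
    by (cases "L1_norm a T f = 0") (auto simp: divide_le_eq)
  have ne: "(\<lambda>_. 0) \<in> L1 a T" by (rule const_in_L1)
  then show "L1_onorm a T A \<le> C"
    unfolding L1_onorm_def by (intro cSUP_least) (use q in auto)
  have bdd: "bdd_above (?q ` L1 a T)"
    using q by (auto simp: bdd_above_def)
  have "?q (\<lambda>_. 0) \<le> L1_onorm a T A"
    unfolding L1_onorm_def by (rule cSUP_upper[OF ne bdd])
  then show "0 \<le> L1_onorm a T A"
    using L1_norm_nonneg by (metis divide_nonneg_nonneg order_trans)
  fix f :: "real \<Rightarrow> 'a" assume f: "f \<in> L1 a T" "L1_norm a T f > 0"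
  have "?q f \<le> L1_onorm a T A"
    unfolding L1_onorm_def by (rule cSUP_upper[OF f(1) bdd])
  then show "L1_norm a T (A f) \<le> L1_onorm a T A * L1_norm a T f"
    using f by (simp add: divide_le_eq)
qed

text \<open>On the interval the constant \<open>1\<close> is the kernel of order \<open>1\<close>
  shifted by \<open>a\<close>, so the value is the kernel of order \<open>\<alpha> + 1\<close> at
  \<open>t - a\<close>.\<close>

lemma RL_integral_one:
  assumes "a < t" "\<alpha> > 0"
  shows "RL_integral a \<alpha> (\<lambda>_. 1 :: 'a::{real_normed_field,banach,second_countable_topology}) t
    = of_real ((t - a) powr \<alpha> / Gamma (\<alpha> + 1))"
proof -
  \<comment> \<open>The right end \<open>t + 1\<close> is an auxiliary choice that puts
    \<open>t\<close> inside the interval.\<close>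
  let ?k = "rl_kernel (t + 1 - a)"
  have "RL_integral a \<alpha> (\<lambda>_. 1 :: 'a) t = convol (?k \<alpha>) (cutoff a (t + 1) (\<lambda>_. 1)) t"
    using assms by (intro RL_integral_eq_convol) auto
  also have "\<dots> = (LINT s|lborel. of_real (?k \<alpha> (t - s) * ?k 1 (s - a)))"
    unfolding convol_def
    by (intro Bochner_Integration.integral_cong)
      (auto simp: cutoff_def rl_kernel_def indicator_def scaleR_conv_of_real)
  also have "\<dots> = of_real (LINT s|lborel. ?k \<alpha> (t - s) * ?k 1 (s - a))"
  proof (rule integral_of_real)
    have "integrable lborel (\<lambda>s. ?k \<alpha> (t - s))"
      using assms by (intro integrable_lborel_reflect rl_kernel_integrable) auto
    then show "integrable lborel (\<lambda>s. ?k \<alpha> (t - s) * ?k 1 (s - a))"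
      by (rule Bochner_Integration.integrable_bound) (auto simp: rl_kernel_def)
  qed
  also have "(LINT s|lborel. ?k \<alpha> (t - s) * ?k 1 (s - a)) = convol (?k \<alpha>) (?k 1) (t - a)"
    using lborel_integral_real_affine[of 1 "\<lambda>s. ?k \<alpha> (t - s) * ?k 1 (s - a)" a]
    by (simp add: convol_def algebra_simps)
  also have "\<dots> = (t - a) powr \<alpha> / Gamma (\<alpha> + 1)"
    using assms by (subst convol_rl_kernel) (auto simp: rl_kernel_def)
  finally show ?thesis .
qed

lemma RL_integral_one_nonzero:
  assumes "a < t" "\<alpha> > 0"
  shows "RL_integral a \<alpha> (\<lambda>_. 1 :: 'a::{real_normed_field,banach,second_countable_topology}) t \<noteq> 0"
  using assms Gamma_real_pos[of "\<alpha> + 1", THEN less_imp_neq] by (auto simp: RL_integral_one)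

text \<open>The integrand agrees almost everywhere with its real part, so the complex integral is
  the embedding of a real integral of a nonnegative function.\<close>

lemma RL_integral_nonneg:
  assumes "a < T" "\<alpha> > 0" and y: "y \<in> L1 a T" "L1_nonneg a T y" and t: "a < t" "t < T"
  shows "RL_integral a \<alpha> y t \<in> \<real>\<^sub>\<ge>\<^sub>0"
proof -
  let ?k = "rl_kernel (T - a) \<alpha>" and ?y = "cutoff a T y"
  have [measurable]: "?y \<in> borel_measurable borel"
    using y by (auto simp: L1_iff dest: borel_measurable_integrable)
  have nonneg: "AE s in lborel. ?y s \<in> \<real>\<^sub>\<ge>\<^sub>0"
    using y(2) unfolding L1_nonneg_iff by eventually_elim (auto simp: cutoff_def indicator_def)
  have "RL_integral a \<alpha> y t = (LINT s|lborel. ?k (t - s) *\<^sub>R ?y s)"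
    using t by (simp add: RL_integral_eq_convol convol_def)
  also have "\<dots> = (LINT s|lborel. complex_of_real (?k (t - s) * Re (?y s)))"
  proof (rule integral_cong_AE)
    show "AE s in lborel. ?k (t - s) *\<^sub>R ?y s = complex_of_real (?k (t - s) * Re (?y s))"
      using nonneg by eventually_elim (auto simp: complex_eq_iff complex_nonneg_Reals_iff)
  qed measurable
  also have "\<dots> = complex_of_real (LINT s|lborel. ?k (t - s) * Re (?y s))"
    by (rule integral_complex_of_real)
  also have "\<dots> \<in> \<real>\<^sub>\<ge>\<^sub>0"
  proof -
    have "AE s in lborel. 0 \<le> ?k (t - s) * Re (?y s)"
      using nonneg by eventually_elim
        (simp add: complex_nonneg_Reals_iff rl_kernel_nonneg[OF \<open>\<alpha> > 0\<close>])
    then show ?thesis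
      by (simp add: integral_nonneg_AE del: of_real_mult)
  qed
  finally show ?thesis .
qed

subsection \<open>Scalar multiples of Riemann--Liouville integrals\<close>

definition scaled_RL ::
  "real \<Rightarrow> (real \<Rightarrow> 'a) \<Rightarrow> real \<Rightarrow> (real \<Rightarrow> 'a::{real_normed_field,banach,second_countable_topology}) \<Rightarrow> real \<Rightarrow> 'a" where
  "scaled_RL a c \<alpha> f t = c \<alpha> * RL_integral a \<alpha> f t"

lemma scaled_RL_operator_family:
  fixes c :: "real \<Rightarrow> 'a::{real_normed_field,banach,second_countable_topology}"
  assumes "a < T"
  shows "L1_operator_family a T (scaled_RL a c)"
  unfolding L1_operator_family_def
proof (intro allI impI)
  fix \<alpha> :: real assume \<alpha>: "\<alpha> > 0"
  have k: "integrable lborel (rl_kernel (T - a) \<alpha>)"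
    using \<open>a < T\<close> \<alpha> by (intro rl_kernel_integrable) auto
  show "L1_operator a T (scaled_RL a c \<alpha>)"
    unfolding L1_operator_def
  proof (intro conjI ballI allI impI)
    fix f :: "real \<Rightarrow> 'a" assume f: "f \<in> L1 a T"
    show "scaled_RL a c \<alpha> f \<in> L1 a T"
      unfolding scaled_RL_def[abs_def] by (intro L1_mult RL_integral_in_L1 assms \<alpha> f)
    show "L1_eq a T (scaled_RL a c \<alpha> (\<lambda>t. d * f t)) (\<lambda>t. d * scaled_RL a c \<alpha> f t)" for d
      by (simp add: L1_eq_iff scaled_RL_def RL_integral_mult mult_ac)
    fix g :: "real \<Rightarrow> 'a" assume g: "g \<in> L1 a T"
    show "L1_eq a T (scaled_RL a c \<alpha> (\<lambda>t. f t + g t)) (\<lambda>t. scaled_RL a c \<alpha> f t + scaled_RL a c \<alpha> g t)"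
      using RL_integral_add[OF assms \<alpha> f g] unfolding L1_eq_iff
      by eventually_elim (auto simp: scaled_RL_def ring_distribs)
    assume eq: "L1_eq a T f g"
    show "L1_eq a T (scaled_RL a c \<alpha> f) (scaled_RL a c \<alpha> g)"
      using convol_cutoff_cong[OF k f g eq]
      by (auto simp: L1_eq_iff scaled_RL_def RL_integral_eq_convol[of a _ T])
  next
    have "L1_norm a T (scaled_RL a c \<alpha> f) \<le> L1_norm a T f * (norm (c \<alpha>) * (LINT s|lborel. \<bar>rl_kernel (T - a) \<alpha> s\<bar>))"
      if "f \<in> L1 a T" for f
      using mult_left_mono[OF RL_integral_norm_le[OF assms \<alpha> that] norm_ge_zero[of "c \<alpha>"]]
      by (simp add: scaled_RL_def[abs_def] L1_norm_mult mult_ac)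
    then show "\<exists>C. \<forall>f\<in>L1 a T. L1_norm a T (scaled_RL a c \<alpha> f) \<le> L1_norm a T f * C" by blast
  qed
qed

text \<open>Testing on the constant \<open>1\<close> at a suitable point, the nonzero value of its
  integral can be cancelled, leaving an equation between scalars.\<close>

lemma scaled_RL_interpolation_cond:
  fixes c :: "real \<Rightarrow> 'a::{real_normed_field,banach,second_countable_topology}"
  assumes "a < T"
  shows "interpolation_cond a T (scaled_RL a c) \<longleftrightarrow> c 1 = 1"
proof
  assume "interpolation_cond a T (scaled_RL a c)"
  then have "L1_eq a T (scaled_RL a c 1 (\<lambda>_. 1)) (RL_integral a 1 (\<lambda>_. 1))"
    unfolding interpolation_cond_def L1_op_eq_def using const_in_L1 by blast
  from L1_AE_ex[OF assms this[unfolded L1_eq_iff]]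
  obtain t where "a < t" "scaled_RL a c 1 (\<lambda>_. 1) t = RL_integral a 1 (\<lambda>_. 1) t"
    by auto
  then show "c 1 = 1"
    using RL_integral_one_nonzero[of a t 1, where ?'a = 'a] by (simp add: scaled_RL_def)
qed (simp add: interpolation_cond_def L1_op_eq_def L1_eq_iff scaled_RL_def)

text \<open>By the semigroup law both sides are multiples of the same integral of order
  \<open>\<alpha> + \<beta>\<close>; the constant \<open>1\<close> shows that the factors must
  agree.\<close>

lemma scaled_RL_index_law:
  fixes c :: "real \<Rightarrow> 'a::{real_normed_field,banach,second_countable_topology}"
  assumes "a < T"
  shows "index_law a T (scaled_RL a c) \<longleftrightarrow> (\<forall>\<alpha>>0. \<forall>\<beta>>0. c \<alpha> * c \<beta> = c (\<alpha> + \<beta>))"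
proof -
  have comp: "L1_eq a T ((scaled_RL a c \<alpha> \<circ> scaled_RL a c \<beta>) f) (\<lambda>t. c \<alpha> * c \<beta> * RL_integral a (\<alpha> + \<beta>) f t)"
    if "\<alpha> > 0" "\<beta> > 0" "f \<in> L1 a T" for \<alpha> \<beta> and f :: "real \<Rightarrow> 'a"
    using RL_integral_semigroup[OF assms that] unfolding L1_eq_iff
    by eventually_elim (auto simp: scaled_RL_def[abs_def] RL_integral_mult)
  show ?thesis
  proof (intro iffI allI impI)
    fix \<alpha> \<beta> :: real assume pos: "\<alpha> > 0" "\<beta> > 0"
    assume "index_law a T (scaled_RL a c)"
    then have "L1_eq a T ((scaled_RL a c \<alpha> \<circ> scaled_RL a c \<beta>) (\<lambda>_. 1)) (scaled_RL a c (\<alpha> + \<beta>) (\<lambda>_. 1))"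
      unfolding index_law_def L1_op_eq_def using pos const_in_L1 by blast
    with comp[OF pos const_in_L1[of 1]]
    have "AE t in lborel. a < t \<and> t < T \<longrightarrow>
      c \<alpha> * c \<beta> * RL_integral a (\<alpha> + \<beta>) (\<lambda>_. 1) t = c (\<alpha> + \<beta>) * RL_integral a (\<alpha> + \<beta>) (\<lambda>_. 1) t"
      unfolding L1_eq_iff by eventually_elim (auto simp: scaled_RL_def)
    from L1_AE_ex[OF assms this] obtain t where "a < t"
      "c \<alpha> * c \<beta> * RL_integral a (\<alpha> + \<beta>) (\<lambda>_. 1) t = c (\<alpha> + \<beta>) * RL_integral a (\<alpha> + \<beta>) (\<lambda>_. 1) t"
      by auto
    then show "c \<alpha> * c \<beta> = c (\<alpha> + \<beta>)"
      using RL_integral_one_nonzero[of a t "\<alpha> + \<beta>", where ?'a = 'a] pos by simp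
  next
    assume c: "\<forall>\<alpha>>0. \<forall>\<beta>>0. c \<alpha> * c \<beta> = c (\<alpha> + \<beta>)"
    show "index_law a T (scaled_RL a c)"
      unfolding index_law_def L1_op_eq_def
    proof (intro allI impI ballI)
      fix \<alpha> \<beta> :: real and f :: "real \<Rightarrow> 'a"
      assume "\<alpha> > 0" "\<beta> > 0" "f \<in> L1 a T"
      with comp[OF this] c show "L1_eq a T ((scaled_RL a c \<alpha> \<circ> scaled_RL a c \<beta>) f) (scaled_RL a c (\<alpha> + \<beta>) f)"
        by (simp add: scaled_RL_def[of a c "\<alpha> + \<beta>", abs_def])
    qed
  qed
qed

lemma scaled_RL_diff_norm_le:
  fixes c :: "real \<Rightarrow> 'a::{real_normed_field,banach,second_countable_topology}"
  assumes aT: "a < T" and \<alpha>: "\<alpha> > 0" and \<beta>: "\<beta> > 0" and f: "f \<in> L1 a T"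
  shows "L1_norm a T (\<lambda>t. scaled_RL a c \<beta> f t - scaled_RL a c \<alpha> f t)
    \<le> (norm (c \<beta>) * (LINT s|lborel. \<bar>rl_kernel (T - a) \<beta> s - rl_kernel (T - a) \<alpha> s\<bar>)
        + norm (c \<beta> - c \<alpha>) * (LINT s|lborel. \<bar>rl_kernel (T - a) \<alpha> s\<bar>)) * L1_norm a T f"
    (is "_ \<le> (_ * ?D + _ * ?M) * _")
proof -
  let ?I = "\<lambda>\<alpha>. RL_integral a \<alpha> f"
  have I: "?I \<alpha> \<in> L1 a T" "?I \<beta> \<in> L1 a T"
    using assms by (auto intro!: RL_integral_in_L1)
  then have d: "(\<lambda>t. ?I \<beta> t - ?I \<alpha> t) \<in> L1 a T" by (simp add: L1_def)
  \<comment> \<open>Adding and subtracting \<open>c \<beta> * ?I \<alpha> t\<close> separates the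
    variation of the integral from that of the factor.\<close>
  have "(\<lambda>t. scaled_RL a c \<beta> f t - scaled_RL a c \<alpha> f t)
      = (\<lambda>t. c \<beta> * (?I \<beta> t - ?I \<alpha> t) + (c \<beta> - c \<alpha>) * ?I \<alpha> t)"
    by (simp add: scaled_RL_def fun_eq_iff algebra_simps)
  then have "L1_norm a T (\<lambda>t. scaled_RL a c \<beta> f t - scaled_RL a c \<alpha> f t)
      \<le> norm (c \<beta>) * L1_norm a T (\<lambda>t. ?I \<beta> t - ?I \<alpha> t) + norm (c \<beta> - c \<alpha>) * L1_norm a T (?I \<alpha>)"
    using L1_norm_add_le[OF L1_mult[OF d] L1_mult[OF I(1)]] by (simp add: L1_norm_mult)
  also have "\<dots> \<le> norm (c \<beta>) * (?D * L1_norm a T f) + norm (c \<beta> - c \<alpha>) * (?M * L1_norm a T f)"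
    using RL_integral_diff_norm_le[OF aT \<alpha> \<beta> f] RL_integral_norm_le[OF aT \<alpha> f]
    by (intro add_mono mult_left_mono) auto
  finally show ?thesis by (simp add: algebra_simps)
qed

text \<open>The operator norm of the difference is squeezed between \<open>0\<close> and the
  preceding bound, which tends to \<open>0\<close> by continuity of \<open>c\<close> and of the
  kernels.\<close>

lemma scaled_RL_norm_continuousI:
  fixes c :: "real \<Rightarrow> 'a::{real_normed_field,banach,second_countable_topology}"
  assumes aT: "a < T" and c: "\<And>\<alpha>. \<alpha> > 0 \<Longrightarrow> (c \<longlongrightarrow> c \<alpha>) (at \<alpha>)"
  shows "norm_continuous a T (scaled_RL a c)"
  unfolding norm_continuous_def
proof (intro allI impI)
  fix \<alpha> :: real assume \<alpha>: "\<alpha> > 0"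
  define C where "C \<beta> = norm (c \<beta>) * (LINT s|lborel. \<bar>rl_kernel (T - a) \<beta> s - rl_kernel (T - a) \<alpha> s\<bar>)
        + norm (c \<beta> - c \<alpha>) * (LINT s|lborel. \<bar>rl_kernel (T - a) \<alpha> s\<bar>)" for \<beta>
  have C0: "C \<beta> \<ge> 0" for \<beta> unfolding C_def by simp
  have "(C \<longlongrightarrow> norm (c \<alpha>) * 0 + norm (c \<alpha> - c \<alpha>) * (LINT s|lborel. \<bar>rl_kernel (T - a) \<alpha> s\<bar>)) (at \<alpha>)"
    unfolding C_def using aT \<alpha> c
    by (intro tendsto_add tendsto_mult tendsto_norm tendsto_diff tendsto_const rl_kernel_L1_continuous) auto
  then have lim: "(C \<longlongrightarrow> 0) (at \<alpha> within {0<..})"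
    by (auto intro: tendsto_within_subset)
  have pos: "\<forall>\<^sub>F \<beta> in at \<alpha> within {0<..}. \<beta> > 0"
    by (simp add: eventually_at_filter)
  show "((\<lambda>\<beta>. L1_onorm a T (\<lambda>f t. scaled_RL a c \<beta> f t - scaled_RL a c \<alpha> f t)) \<longlongrightarrow> 0) (at \<alpha> within {0<..})"
  proof (rule tendsto_sandwich[OF _ _ tendsto_const lim])
    show "\<forall>\<^sub>F \<beta> in at \<alpha> within {0<..}. 0 \<le> L1_onorm a T (\<lambda>f t. scaled_RL a c \<beta> f t - scaled_RL a c \<alpha> f t)"
      using pos by eventually_elim
        (rule L1_onorm_le(1)[OF _ C0], use scaled_RL_diff_norm_le[OF aT \<alpha>] in \<open>simp add: C_def\<close>)
    show "\<forall>\<^sub>F \<beta> in at \<alpha> within {0<..}. L1_onorm a T (\<lambda>f t. scaled_RL a c \<beta> f t - scaled_RL a c \<alpha> f t) \<le> C \<beta>"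
      using pos by eventually_elim
        (rule L1_onorm_le(2)[OF _ C0], use scaled_RL_diff_norm_le[OF aT \<alpha>] in \<open>simp add: C_def\<close>)
  qed
qed

text \<open>Testing norm continuity on the constant \<open>1\<close>: the mean of \<open>scaled_RL a c \<beta> 1\<close> over \<open>(a,T)\<close> is
  \<open>c \<beta>\<close> times a positive number that depends continuously on \<open>\<beta>\<close>.\<close>

lemma scaled_RL_norm_continuousD:
  fixes c :: "real \<Rightarrow> 'a::{real_normed_field,banach,second_countable_topology}"
  assumes aT: "a < T" and cont: "norm_continuous a T (scaled_RL a c)" and \<alpha>: "\<alpha> > 0"
  shows "(c \<longlongrightarrow> c \<alpha>) (at \<alpha>)"
proof -
  define M where "M = Defs.interval_measure a T"
  define m where "m \<beta> = (LINT t|M. RL_integral a \<beta> (\<lambda>_. 1 :: 'a) t)" for \<beta>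
  have nbhd: "at \<alpha> within {0<..} = at \<alpha>" using \<alpha> by (intro at_within_open) auto
  have \<Gamma>: "Gamma (\<alpha> + 1) > 0" using \<alpha> by (intro Gamma_real_pos) simp
  have one: "(\<lambda>_. 1 :: 'a) \<in> L1 a T" by (rule const_in_L1)
  have norm_one: "L1_norm a T (\<lambda>_. 1 :: 'a) > 0"
    using aT by (simp add: L1_norm_cutoff cutoff_def)
  \<comment> \<open>Stated for general \<open>d\<close> because it is used twice:
    \<open>d = 1\<close> yields continuity of \<open>m\<close>, \<open>d = c\<close> that of the
    product, and division recovers \<open>c\<close>.\<close>
  have lim: "((\<lambda>\<beta>. d \<beta> * m \<beta>) \<longlongrightarrow> d \<alpha> * m \<alpha>) (at \<alpha>)"
    if "norm_continuous a T (scaled_RL a d)" for d :: "real \<Rightarrow> 'a"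
  proof -
    let ?N = "\<lambda>\<beta>. L1_onorm a T (\<lambda>f t. scaled_RL a d \<beta> f t - scaled_RL a d \<alpha> f t)"
    have "(?N \<longlongrightarrow> 0) (at \<alpha>)"
      using that[unfolded norm_continuous_def, rule_format, OF \<alpha>] by (simp only: nbhd)
    then have N: "((\<lambda>\<beta>. ?N \<beta> * L1_norm a T (\<lambda>_. 1 :: 'a)) \<longlongrightarrow> 0) (at \<alpha>)"
      by (rule tendsto_mult_left_zero)
    have "\<forall>\<^sub>F \<beta> in at \<alpha>. \<beta> > 0"
      using order_tendstoD(1)[OF tendsto_ident_at \<alpha>] .
    then have "\<forall>\<^sub>F \<beta> in at \<alpha>. norm (d \<beta> * m \<beta> - d \<alpha> * m \<alpha>) \<le> ?N \<beta> * L1_norm a T (\<lambda>_. 1 :: 'a)"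
    proof eventually_elim
      case \<beta>: (elim \<beta>)
      have int: "integrable M (RL_integral a \<gamma> (\<lambda>_. 1 :: 'a))" if "\<gamma> > 0" for \<gamma>
        using RL_integral_in_L1[OF aT that one] by (simp add: L1_def M_def)
      have "d \<beta> * m \<beta> - d \<alpha> * m \<alpha>
          = (LINT t|M. scaled_RL a d \<beta> (\<lambda>_. 1) t - scaled_RL a d \<alpha> (\<lambda>_. 1) t)"
        using int[OF \<alpha>] int[OF \<beta>] by (simp add: scaled_RL_def m_def)
      also have "norm \<dots> \<le> L1_norm a T (\<lambda>t. scaled_RL a d \<beta> (\<lambda>_. 1) t - scaled_RL a d \<alpha> (\<lambda>_. 1) t)"
        unfolding L1_norm_def M_def by (rule integral_norm_bound)
      also have "\<dots> \<le> ?N \<beta> * L1_norm a T (\<lambda>_. 1 :: 'a)"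
        using L1_onorm_le(3)[OF scaled_RL_diff_norm_le[OF aT \<alpha> \<beta>] _ one norm_one, of d] by simp
      finally show ?case .
    qed
    then show ?thesis
      by (rule LIM_zero_cancel[OF Lim_null_comparison[OF _ N]])
  qed
  \<comment> \<open>\<open>m \<alpha>\<close> is the integral of a function that is positive on the
    interval; if it were \<open>0\<close>, that function would vanish at some point of
    \<open>(a,T)\<close>.\<close>
  have "m \<alpha> \<noteq> 0"
  proof
    let ?r = "\<lambda>t. (t - a) powr \<alpha> / Gamma (\<alpha> + 1)"
    assume "m \<alpha> = 0"
    have "m \<alpha> = (LINT t|M. of_real (?r t))"
      unfolding m_def using \<alpha>
      by (intro Bochner_Integration.integral_cong)
        (auto simp: M_def Defs.interval_measure_def space_restrict_space RL_integral_one)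
    moreover have int: "integrable M ?r"
    proof -
      have "integrable M (\<lambda>t. norm (RL_integral a \<alpha> (\<lambda>_. 1 :: 'a) t))"
        using RL_integral_in_L1[OF aT \<alpha> one] by (simp add: L1_def M_def)
      then show ?thesis
        by (rule Bochner_Integration.integrable_cong[THEN iffD1, rotated -1])
          (use \<alpha> \<Gamma> in
            \<open>auto simp: M_def Defs.interval_measure_def space_restrict_space RL_integral_one norm_divide\<close>)
    qed
    ultimately have "(LINT t|M. ?r t) = 0"
      using \<open>m \<alpha> = 0\<close> integral_of_real[OF int, where ?'a = 'a] by (metis of_real_eq_0_iff)
    moreover note int
    moreover have "?r t \<ge> 0" for t using \<alpha> \<Gamma> by simp
    ultimately have "AE t in M. ?r t = 0"
      by (subst (asm) integral_nonneg_eq_0_iff_AE) auto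
    then have "AE t in lborel. a < t \<and> t < T \<longrightarrow> ?r t = 0"
      unfolding M_def Defs.interval_measure_def by (subst (asm) AE_restrict_space_iff) auto
    from L1_AE_ex[OF aT this] show False
      using \<alpha> \<Gamma> by auto
  qed
  moreover have "(m \<longlongrightarrow> m \<alpha>) (at \<alpha>)"
    using lim[of "\<lambda>_. 1", OF scaled_RL_norm_continuousI[OF aT]] by simp
  moreover note lim[OF cont]
  ultimately have "((\<lambda>\<beta>. c \<beta> * m \<beta> / m \<beta>) \<longlongrightarrow> c \<alpha> * m \<alpha> / m \<alpha>) (at \<alpha>)"
    by (intro tendsto_divide) auto
  moreover have "\<forall>\<^sub>F \<beta> in at \<alpha>. c \<beta> * m \<beta> / m \<beta> = c \<beta>"
    using tendsto_imp_eventually_ne[OF \<open>(m \<longlongrightarrow> m \<alpha>) (at \<alpha>)\<close> \<open>m \<alpha> \<noteq> 0\<close>] by eventually_elim simp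
  ultimately show ?thesis
    using \<open>m \<alpha> \<noteq> 0\<close> by (simp add: tendsto_cong)
qed

text \<open>On the constant \<open>1\<close> the value at a suitable point is
  \<open>c \<alpha>\<close> times a positive real, which forces \<open>c \<alpha>\<close> to be a
  nonnegative real.\<close>

lemma scaled_RL_positivity_preserving:
  assumes "a < T"
  shows "positivity_preserving a T (scaled_RL a c) \<longleftrightarrow> (\<forall>\<alpha>>0. c \<alpha> \<in> \<real>\<^sub>\<ge>\<^sub>0)"
proof (intro iffI allI impI)
  fix \<alpha> :: real assume \<alpha>: "\<alpha> > 0"
  assume "positivity_preserving a T (scaled_RL a c)"
  then have "L1_nonneg a T (scaled_RL a c \<alpha> (\<lambda>_. 1))"
    using const_in_L1[of "1 :: complex" a T] \<alpha> by (simp add: positivity_preserving_def L1_nonneg_iff)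
  from L1_AE_ex[OF assms this[unfolded L1_nonneg_iff]]
  obtain t where t: "a < t" and "scaled_RL a c \<alpha> (\<lambda>_. 1) t \<in> \<real>\<^sub>\<ge>\<^sub>0"
    by auto
  moreover define r where "r = (t - a) powr \<alpha> / Gamma (\<alpha> + 1)"
  ultimately have "c \<alpha> * of_real r \<in> \<real>\<^sub>\<ge>\<^sub>0"
    using \<alpha> by (simp add: scaled_RL_def RL_integral_one)
  moreover have "r > 0"
    unfolding r_def
    using t \<alpha> by (intro divide_pos_pos Gamma_real_pos) auto
  ultimately show "c \<alpha> \<in> \<real>\<^sub>\<ge>\<^sub>0"
    by (simp add: complex_nonneg_Reals_iff zero_le_mult_iff)
next
  assume "\<forall>\<alpha>>0. c \<alpha> \<in> \<real>\<^sub>\<ge>\<^sub>0"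
  then show "positivity_preserving a T (scaled_RL a c)"
    using RL_integral_nonneg[OF assms]
    by (auto simp: positivity_preserving_def L1_nonneg_iff[of a T "scaled_RL a c _ _"] scaled_RL_def
        intro!: nonneg_Reals_mult_I)
qed

subsection \<open>The counterexamples\<close>

text \<open>The reals are viewed as a vector space over the rationals, and \<open>\<phi>\<close> is
  a coordinate with respect to a Hamel basis extending \<open>{\<rho>, 1}\<close>. Extending to a
  basis is where Zorn's lemma enters. Vanishing on the dense set of rationals while
  \<open>\<phi> \<rho> = 1\<close> rules out continuity at \<open>\<rho>\<close>.\<close>

lemma ex_discontinuous_additive:
  obtains \<phi> :: "real \<Rightarrow> real" and \<rho> :: real
  where "\<And>x y. \<phi> (x + y) = \<phi> x + \<phi> y" "\<And>q. q \<in> \<rat> \<Longrightarrow> \<phi> q = 0" "\<rho> > 0" "\<phi> \<rho> = 1"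
proof -
  interpret Q: vector_space "\<lambda>(q::rat) (x::real). of_rat q * x"
    by unfold_locales (auto simp: of_rat_add of_rat_mult algebra_simps)
  interpret QQ: vector_space_pair "\<lambda>(q::rat) (x::real). of_rat q * x" "\<lambda>(q::rat) (x::real). of_rat q * x" ..
  have "\<not> {0<..<1} \<subseteq> (\<rat> :: real set)"
    using countable_subset[OF _ countable_rat] uncountable_open_interval[of "0::real" 1] by auto
  then obtain \<rho> :: real where \<rho>: "\<rho> > 0" "\<rho> \<notin> \<rat>"
    unfolding subset_iff greaterThanLessThan_iff by blast
  \<comment> \<open>The rational span of \<open>1\<close> is the set of rationals, so irrationality
    of \<open>\<rho>\<close> is linear independence from \<open>1\<close>.\<close>
  have "\<rho> \<notin> Q.span {1}"
    using \<rho> by (auto simp: Q.span_singleton)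
  then have ind: "Q.independent {\<rho>, 1}"
    by (simp add: Q.independent_insert)
  define \<phi> where "\<phi> = QQ.construct {\<rho>, 1} (\<lambda>x. if x = \<rho> then 1 else 0)"
  interpret L: Vector_Spaces.linear "\<lambda>(q::rat) (x::real). of_rat q * x" "\<lambda>(q::rat) (x::real). of_rat q * x" \<phi>
    unfolding \<phi>_def by (rule QQ.linear_construct[OF ind])
  have "\<rho> \<noteq> 1" using \<rho> by auto
  then have \<phi>: "\<phi> \<rho> = 1" "\<phi> 1 = 0"
    unfolding \<phi>_def using ind by (auto simp: QQ.construct_basis)
  have "\<phi> q = 0" if "q \<in> \<rat>" for q
    using that L.scale[of _ 1] \<phi> by (auto elim!: Rats_cases)
  with \<phi> \<rho> L.add that show ?thesis by blast
qed

theorem theorem2p3: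
  fixes a T :: real
  assumes "a < T"
  shows
    "((\<exists>J :: real \<Rightarrow> (real \<Rightarrow> real) \<Rightarrow> (real \<Rightarrow> real). L1_operator_family a T J \<and>
         \<not> interpolation_cond a T J \<and> index_law a T J \<and> norm_continuous a T J) \<and>
      (\<exists>J :: real \<Rightarrow> (real \<Rightarrow> real) \<Rightarrow> (real \<Rightarrow> real). L1_operator_family a T J \<and>
         interpolation_cond a T J \<and> \<not> index_law a T J \<and> norm_continuous a T J) \<and>
      (\<exists>J :: real \<Rightarrow> (real \<Rightarrow> real) \<Rightarrow> (real \<Rightarrow> real). L1_operator_family a T J \<and>
         interpolation_cond a T J \<and> index_law a T J \<and> \<not> norm_continuous a T J)) \<and>
     ((\<exists>J :: real \<Rightarrow> (real \<Rightarrow> complex) \<Rightarrow> (real \<Rightarrow> complex). L1_operator_family a T J \<and>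
         \<not> interpolation_cond a T J \<and> index_law a T J \<and> norm_continuous a T J \<and>
         positivity_preserving a T J) \<and>
      (\<exists>J :: real \<Rightarrow> (real \<Rightarrow> complex) \<Rightarrow> (real \<Rightarrow> complex). L1_operator_family a T J \<and>
         interpolation_cond a T J \<and> \<not> index_law a T J \<and> norm_continuous a T J \<and>
         positivity_preserving a T J) \<and>
      (\<exists>J :: real \<Rightarrow> (real \<Rightarrow> complex) \<Rightarrow> (real \<Rightarrow> complex). L1_operator_family a T J \<and>
         interpolation_cond a T J \<and> index_law a T J \<and> \<not> norm_continuous a T J \<and>
         positivity_preserving a T J) \<and>
      (\<exists>J :: real \<Rightarrow> (real \<Rightarrow> complex) \<Rightarrow> (real \<Rightarrow> complex). L1_operator_family a T J \<and>
         interpolation_cond a T J \<and> index_law a T J \<and> norm_continuous a T J \<and>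
         \<not> positivity_preserving a T J))"
proof -
  obtain \<phi> :: "real \<Rightarrow> real" and \<rho> where \<phi>: "\<And>x y. \<phi> (x + y) = \<phi> x + \<phi> y"
    "\<And>q. q \<in> \<rat> \<Longrightarrow> \<phi> q = 0" and \<rho>: "\<rho> > 0" "\<phi> \<rho> = 1"
    using ex_discontinuous_additive by blast
  note crit = scaled_RL_operator_family[OF assms] scaled_RL_interpolation_cond[OF assms] scaled_RL_index_law[OF assms]
    scaled_RL_positivity_preserving[OF assms]
  \<comment> \<open>The first three scalar functions are used over both fields; \<open>?cis\<close>
    is available over the complex numbers only.\<close>
  let ?zero = "\<lambda>_. 0" and ?lin = "\<lambda>\<alpha>. of_real \<alpha>" and ?exp = "\<lambda>\<alpha>. of_real (exp (\<phi> \<alpha>))"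
    and ?cis = "\<lambda>\<alpha>. cis (2 * pi * \<alpha>)"
  have zero: "?zero 1 \<noteq> (1 :: 'a::real_normed_field)" "?zero \<alpha> * ?zero \<beta> = (?zero (\<alpha> + \<beta>) :: 'a)"
      "(?zero \<alpha> :: complex) \<in> \<real>\<^sub>\<ge>\<^sub>0" for \<alpha> \<beta> :: real
    by auto
  \<comment> \<open>The product rule already fails at \<open>\<alpha> = \<beta> = 1\<close>, where
    it would read \<open>1 = 2\<close>.\<close>
  have lin: "?lin 1 = (1 :: 'a::real_normed_field)" "\<not> (\<forall>\<alpha>>0. \<forall>\<beta>>0. ?lin \<alpha> * ?lin \<beta> = (?lin (\<alpha> + \<beta>) :: 'a))"
      "\<forall>\<alpha>>0. (?lin \<alpha> :: complex) \<in> \<real>\<^sub>\<ge>\<^sub>0"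
    by (auto intro!: exI[of _ 1])
  have exp: "?exp 1 = (1 :: 'a::real_normed_field)" "?exp \<alpha> * ?exp \<beta> = (?exp (\<alpha> + \<beta>) :: 'a)"
      "(?exp \<alpha> :: complex) \<in> \<real>\<^sub>\<ge>\<^sub>0" for \<alpha> \<beta>
    using \<phi>(2)[of 1] by (simp_all add: \<phi>(1) exp_add)
  \<comment> \<open>Continuity at \<open>\<rho>\<close> would keep
    \<open>exp (\<phi> \<alpha>)\<close> above \<open>1\<close> near \<open>\<rho>\<close>, since
    its value there is \<open>exp 1\<close>; but it equals \<open>1\<close> at every
    rational.\<close>
  have not_cont: "\<not> norm_continuous a T (scaled_RL a (?exp :: real \<Rightarrow> 'a::{real_normed_field,banach,second_countable_topology}))"
  proof
    assume "norm_continuous a T (scaled_RL a (?exp :: real \<Rightarrow> 'a))"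
    then have "((?exp :: real \<Rightarrow> 'a) \<longlongrightarrow> ?exp \<rho>) (at \<rho>)"
      using scaled_RL_norm_continuousD[OF assms _ \<rho>(1)] by blast
    then have "((\<lambda>\<alpha>. norm (?exp \<alpha> :: 'a)) \<longlongrightarrow> norm (?exp \<rho> :: 'a)) (at \<rho>)"
      by (rule tendsto_norm)
    then have "((\<lambda>\<alpha>. exp (\<phi> \<alpha>)) \<longlongrightarrow> exp 1) (at \<rho>)"
      by (simp add: \<rho>(2))
    then have "\<forall>\<^sub>F \<alpha> in at \<rho>. 1 < exp (\<phi> \<alpha>)"
      by (rule order_tendstoD(1)) simp
    then obtain d where d: "d > 0" "\<And>\<alpha>. \<alpha> \<noteq> \<rho> \<Longrightarrow> dist \<alpha> \<rho> < d \<Longrightarrow> 1 < exp (\<phi> \<alpha>)"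
      unfolding eventually_at by blast
    obtain q where q: "q \<in> \<rat>" "\<rho> < q" "q < \<rho> + d"
      using Rats_dense_in_real[of \<rho> "\<rho> + d"] d(1) by auto
    then have "1 < exp (\<phi> q)" by (intro d(2)) (auto simp: dist_real_def)
    with \<phi>(2)[OF q(1)] show False by simp
  qed
  have cont: "norm_continuous a T (scaled_RL a (?zero :: real \<Rightarrow> 'a::{real_normed_field,banach,second_countable_topology}))"
      "norm_continuous a T (scaled_RL a (?lin :: real \<Rightarrow> 'a))"
    by (auto intro!: scaled_RL_norm_continuousI[OF assms] tendsto_intros)
  have cont_cis: "norm_continuous a T (scaled_RL a ?cis)"
    unfolding cis_conv_exp by (intro scaled_RL_norm_continuousI[OF assms] tendsto_intros)
  \<comment> \<open>At order \<open>1/2\<close> the factor is \<open>cis pi = -1\<close>.\<close>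
  have "?cis (1/2) \<notin> \<real>\<^sub>\<ge>\<^sub>0"
    by (simp add: complex_nonneg_Reals_iff)
  then have cis: "?cis 1 = 1" "?cis \<alpha> * ?cis \<beta> = ?cis (\<alpha> + \<beta>)" "\<not> (\<forall>\<alpha>>0. ?cis \<alpha> \<in> \<real>\<^sub>\<ge>\<^sub>0)" for \<alpha> \<beta>
    by (auto simp: cis_mult ring_distribs intro!: exI[of _ "1/2"])
  show ?thesis
  proof (intro conjI)
    show "\<exists>J :: real \<Rightarrow> (real \<Rightarrow> real) \<Rightarrow> (real \<Rightarrow> real). L1_operator_family a T J \<and>
        \<not> interpolation_cond a T J \<and> index_law a T J \<and> norm_continuous a T J"
      by (rule exI[of _ "scaled_RL a ?zero"])
        (simp only: crit not_False_eq_True simp_thms zero cont cong: imp_cong)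
  next
    show "\<exists>J :: real \<Rightarrow> (real \<Rightarrow> real) \<Rightarrow> (real \<Rightarrow> real). L1_operator_family a T J \<and>
        interpolation_cond a T J \<and> \<not> index_law a T J \<and> norm_continuous a T J"
      by (rule exI[of _ "scaled_RL a ?lin"])
        (simp only: crit not_False_eq_True simp_thms lin cont cong: imp_cong)
  next
    show "\<exists>J :: real \<Rightarrow> (real \<Rightarrow> real) \<Rightarrow> (real \<Rightarrow> real). L1_operator_family a T J \<and>
        interpolation_cond a T J \<and> index_law a T J \<and> \<not> norm_continuous a T J"
      by (rule exI[of _ "scaled_RL a ?exp"])
        (simp only: crit not_False_eq_True simp_thms exp not_cont cong: imp_cong)
  next
    show "\<exists>J :: real \<Rightarrow> (real \<Rightarrow> complex) \<Rightarrow> (real \<Rightarrow> complex). L1_operator_family a T J \<and>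
        \<not> interpolation_cond a T J \<and> index_law a T J \<and> norm_continuous a T J \<and>
        positivity_preserving a T J"
      by (rule exI[of _ "scaled_RL a ?zero"])
        (simp only: crit not_False_eq_True simp_thms zero cont cong: imp_cong)
  next
    show "\<exists>J :: real \<Rightarrow> (real \<Rightarrow> complex) \<Rightarrow> (real \<Rightarrow> complex). L1_operator_family a T J \<and>
        interpolation_cond a T J \<and> \<not> index_law a T J \<and> norm_continuous a T J \<and>
        positivity_preserving a T J"
      by (rule exI[of _ "scaled_RL a ?lin"])
        (simp only: crit not_False_eq_True simp_thms lin cont cong: imp_cong)
  next
    show "\<exists>J :: real \<Rightarrow> (real \<Rightarrow> complex) \<Rightarrow> (real \<Rightarrow> complex). L1_operator_family a T J \<and>
        interpolation_cond a T J \<and> index_law a T J \<and> \<not> norm_continuous a T J \<and>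
        positivity_preserving a T J"
      by (rule exI[of _ "scaled_RL a ?exp"])
        (simp only: crit not_False_eq_True simp_thms exp not_cont cong: imp_cong)
  next
    show "\<exists>J :: real \<Rightarrow> (real \<Rightarrow> complex) \<Rightarrow> (real \<Rightarrow> complex). L1_operator_family a T J \<and>
        interpolation_cond a T J \<and> index_law a T J \<and> norm_continuous a T J \<and>
        \<not> positivity_preserving a T J"
      by (rule exI[of _ "scaled_RL a ?cis"])
        (simp only: crit not_False_eq_True simp_thms cis cont_cis cong: imp_cong)
  qed
qed

end
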